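(* Let $p$ be any one of the patterns $10$, $001$, $010$, $011$. Then for every $n\ge 1$, the number of ascent sequences of length $n$ that avoid $p$ is $2^{n-1}$. Moreover, for every $k\ge 0$, the number of ascent sequences of length $n$ avoiding $p$ and having exactly $k$ ascents is $\binom{n-1}{k}$.
   Context: An ascent sequence is a finite sequence $x_1x_2\ldots x_n$ of nonnegative integers with $x_1=0$ and $x_i\le \operatorname{asc}(x_1\ldots x_{i-1})+1$ for all $1<i\le n$, where $\operatorname{asc}(y_1\ldots y_k)$, the number of ascents, is the number of indices $j$ with $y_j<y_{j+1}$. A pattern is a finite word over the nonnegative integers (repetitions allowed). An occurrence of a pattern $p=p_1\ldots p_k$ in a sequence $x_1\ldots x_n$ is a subsequence $x_{i_1}\ldots x_{i_k}$ with $i_1<\cdots<i_k$ such that for all $a,b$: $x_{i_a}<x_{i_b}$ iff $p_a<p_b$, and $x_{i_a}=x_{i_b}$ iff $p_a=p_b$. A sequence avoids $p$ if it has no occurrence of $p$. *)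

theory Defs
  imports Main
begin

text \<open>
  Sequences \<open>x\<^sub>1 \<dots> x\<^sub>n\<close> and patterns are lists of natural numbers, indexed from 0,
  so \<open>x\<^sub>i\<close> is \<open>xs ! (i - 1)\<close>.
\<close>

definition asc :: "nat list \<Rightarrow> nat" where
  "asc xs = card {j. Suc j < length xs \<and> xs ! j < xs ! Suc j}"

text \<open>
  The condition \<open>x\<^sub>1 = 0\<close> presupposes a first entry: the empty list is not an ascent sequence.
\<close>

definition ascent_sequence :: "nat list \<Rightarrow> bool" where
  "ascent_sequence xs \<longleftrightarrow>
     xs \<noteq> [] \<and> xs ! 0 = 0 \<and>
     (\<forall>i. 0 < i \<and> i < length xs \<longrightarrow> xs ! i \<le> asc (take i xs) + 1)"

text \<open>
  An occurrence is given by its strictly increasing list of positions \<open>ps\<close>.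
\<close>

definition occurrence :: "nat list \<Rightarrow> nat list \<Rightarrow> nat list \<Rightarrow> bool" where
  "occurrence p xs ps \<longleftrightarrow>
     length ps = length p \<and> sorted_wrt (<) ps \<and> set ps \<subseteq> {..<length xs} \<and>
     (\<forall>a<length p. \<forall>b<length p.
        (xs ! (ps ! a) < xs ! (ps ! b) \<longleftrightarrow> p ! a < p ! b) \<and>
        (xs ! (ps ! a) = xs ! (ps ! b) \<longleftrightarrow> p ! a = p ! b))"

definition avoids :: "nat list \<Rightarrow> nat list \<Rightarrow> bool" where
  "avoids xs p \<longleftrightarrow> \<not> (\<exists>ps. occurrence p xs ps)"

end

theory Submission
  imports Defs
begin

text \<open>
  For each pattern, the avoiders of length \<open>n + 1\<close> arise from those of length \<open>n\<close> by two
  injective operations with disjoint images, one preserving the number of ascents and the other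
  increasing it by one; Pascal's rule then gives the counts. For \<open>10\<close> and \<open>010\<close>, which have the
  same avoiders, one appends \<open>asc xs\<close> or \<open>asc xs + 1\<close>; for \<open>011\<close> one appends \<open>0\<close> or
  \<open>asc xs + 1\<close>. An avoider of \<open>001\<close> of length at least two either ends in \<open>0\<close>, which can be
  deleted, or has its only \<open>0\<close> in front, and then deleting it and decreasing all other entries
  gives an avoider.
\<close>

section \<open>Counting by Pascal's rule\<close>

text \<open>The members of \<open>A (Suc n)\<close> with statistic \<open>k\<close> are the disjoint
  union of the \<open>f\<close>-image of level \<open>k\<close> and the \<open>g\<close>-image of
  level \<open>k - 1\<close> of \<open>A n\<close>. In the applications \<open>A n\<close> holds the
  avoiders of length \<open>n + 1\<close>, so \<open>A 0\<close> consists of the sequence 0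
  alone.\<close>

lemma pascal_count:
  fixes A :: "nat \<Rightarrow> 'a set" and s :: "'a \<Rightarrow> nat"
  assumes A0: "A 0 = {a}" "s a = 0"
    and step: "\<And>n. A (Suc n) = f ` A n \<union> g ` A n"
    and inj: "\<And>n. inj_on f (A n)" "\<And>n. inj_on g (A n)"
    and disj: "\<And>n x y. x \<in> A n \<Longrightarrow> y \<in> A n \<Longrightarrow> f x \<noteq> g y"
    and sf: "\<And>n x. x \<in> A n \<Longrightarrow> s (f x) = s x"
    and sg: "\<And>n x. x \<in> A n \<Longrightarrow> s (g x) = Suc (s x)"
  shows "card (A n) = 2 ^ n \<and> (\<forall>k. card {x \<in> A n. s x = k} = n choose k)"
proof -
  have fin: "finite (A n)" for n
    by (induction n) (simp_all add: A0 step)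
  have all: "card (A n) = 2 ^ n"
  proof (induction n)
    case 0
    then show ?case by (simp add: A0)
  next
    case (Suc n)
    have "f ` A n \<inter> g ` A n = {}"
      using disj by blast
    then show ?case
      using Suc by (simp add: step fin card_Un_disjoint card_image inj)
  qed
  have "card {x \<in> A n. s x = k} = n choose k" for k
  proof (induction n arbitrary: k)
    case 0
    have "{x \<in> A 0. s x = k} = (if k = 0 then {a} else {})"
      using A0 by auto
    then show ?case by simp
  next
    case (Suc n)
    have f_card: "card (f ` {x \<in> A n. s x = j}) = n choose j" for j
      using Suc by (subst card_image) (auto intro: inj_on_subset[OF inj(1)])
    have g_card: "card (g ` {x \<in> A n. s x = j}) = n choose j" for j
      using Suc by (subst card_image) (auto intro: inj_on_subset[OF inj(2)])
    show ?case
    proof (cases k)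
      case 0
      \<comment> \<open>Every value of \<open>g\<close> has positive statistic, so level 0 comes
        from \<open>f\<close> only.\<close>
      have "{x \<in> A (Suc n). s x = k} = f ` {x \<in> A n. s x = 0}"
        using 0 by (auto simp: step sf sg)
      then show ?thesis using 0 by (simp add: f_card)
    next
      case (Suc j)
      have "{x \<in> A (Suc n). s x = k} = f ` {x \<in> A n. s x = k} \<union> g ` {x \<in> A n. s x = j}"
        using Suc by (auto simp: step sf sg)
      moreover have "f ` {x \<in> A n. s x = k} \<inter> g ` {x \<in> A n. s x = j} = {}"
        using disj by blast
      ultimately show ?thesis
        using Suc by (simp add: card_Un_disjoint fin f_card g_card)
    qed
  qed
  with all show ?thesis by blast
qed

section \<open>Ascents under appending and shifting\<close>

lemma asc_Nil [simp]: "asc [] = 0"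
  by (simp add: asc_def)

lemma asc_singleton [simp]: "asc [x] = 0"
  by (simp add: asc_def)

lemma asc_snoc: "asc (xs @ [y]) = asc xs + (if xs \<noteq> [] \<and> last xs < y then 1 else 0)"
proof -
  let ?J = "{j. Suc j < length xs \<and> xs ! j < xs ! Suc j}"
  \<comment> \<open>\<open>?L\<close> holds the one new index, that of the pair
    \<open>last xs\<close>, \<open>y\<close>, when this pair is an ascent. The condition
    \<open>xs \<noteq> []\<close> excludes the truncated value \<open>0 - 1 = 0\<close>.\<close>
  let ?L = "{j. xs \<noteq> [] \<and> j = length xs - 1 \<and> last xs < y}"
  have "{j. Suc j < length (xs @ [y]) \<and> (xs @ [y]) ! j < (xs @ [y]) ! Suc j} = ?J \<union> ?L"
    (is "?K = _")
  proof (rule set_eqI)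
    fix j
    consider "Suc j < length xs" | "length xs = Suc j" | "length xs < Suc j"
      by linarith
    then show "j \<in> ?K \<longleftrightarrow> j \<in> ?J \<union> ?L"
    proof cases
      case 1
      then show ?thesis by (auto simp: nth_append)
    next
      case 2
      then have "xs \<noteq> []" by auto
      with 2 show ?thesis by (simp add: nth_append last_conv_nth)
    next
      case 3
      then show ?thesis by (cases "xs = []") auto
    qed
  qed
  moreover have "card (?J \<union> ?L) = card ?J + card ?L"
    by (intro card_Un_disjoint) (auto intro: finite_subset[of _ "{..<length xs}"])
  moreover have "card ?L = (if xs \<noteq> [] \<and> last xs < y then 1 else 0)"
    by simp
  ultimately show ?thesis
    by (simp add: asc_def)
qed

lemma ascent_sequence_snoc:
  "ascent_sequence (xs @ [y]) \<longleftrightarrow>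
    (if xs = [] then y = 0 else ascent_sequence xs \<and> y \<le> Suc (asc xs))"
  by (cases "xs = []") (auto simp: ascent_sequence_def nth_append less_Suc_eq)

lemma ascent_sequence_singleton [simp]: "ascent_sequence [x] \<longleftrightarrow> x = 0"
  using ascent_sequence_snoc[of "[]" x] by simp

text \<open>A new entry above \<open>asc xs\<close> must equal \<open>asc xs + 1\<close>. By
  induction it exceeds \<open>last xs\<close>, so it creates an ascent and the bound rises with
  it.\<close>

lemma ascent_sequence_le_asc: "ascent_sequence xs \<Longrightarrow> x \<in> set xs \<Longrightarrow> x \<le> asc xs"
proof (induction xs arbitrary: x rule: rev_induct)
  case (snoc y xs)
  show ?case
  proof (cases "xs = []")
    case False
    then have "last xs \<le> asc xs" "x \<in> set xs \<Longrightarrow> x \<le> asc xs" "y \<le> Suc (asc xs)"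
      using snoc by (simp_all add: ascent_sequence_snoc)
    then show ?thesis
      using False snoc.prems(2) by (cases "x = y") (auto simp: asc_snoc le_SucI)
  qed (use snoc in \<open>simp add: ascent_sequence_def\<close>)
qed simp

text \<open>Shifting all entries preserves ascents; the step from the leading 0 to a positive entry
  adds one.\<close>

lemma asc_Cons_map_Suc: "xs \<noteq> [] \<Longrightarrow> asc (0 # map Suc xs) = Suc (asc xs)"
proof (induction xs rule: rev_induct)
  case (snoc y xs)
  then show ?case
    using asc_snoc[of "0 # map Suc xs" "Suc y"] asc_snoc[of "[0]" "Suc y"]
    by (cases "xs = []") (auto simp: asc_snoc last_map)
qed simp

text \<open>Each shifted entry is larger by one, and so is its bound, because of the additional
  ascent at the front.\<close>

lemma ascent_sequence_Cons_map_Suc: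
  "xs \<noteq> [] \<Longrightarrow> ascent_sequence (0 # map Suc xs) \<longleftrightarrow> ascent_sequence xs"
proof (induction xs rule: rev_induct)
  case (snoc y xs)
  then show ?case
    using ascent_sequence_snoc[of "0 # map Suc xs" "Suc y"]
      ascent_sequence_snoc[of "[0]" "Suc y"]
    by (cases "xs = []") (auto simp: ascent_sequence_snoc asc_Cons_map_Suc)
qed simp

text \<open>Otherwise the simplifier rewrites the letter 1 of a pattern to \<open>Suc 0\<close>.\<close>

declare One_nat_def [simp del]

section \<open>Avoidance in terms of indices\<close>

lemma avoids_10:
  "avoids xs [1, 0] \<longleftrightarrow> \<not> (\<exists>i j. i < j \<and> j < length xs \<and> xs ! j < xs ! i)"
proof -
  have "\<exists>i j. ps = [i, j]" if "occurrence [1, 0] xs ps" for ps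
    using that by (auto simp: occurrence_def length_Suc_conv)
  then have "(\<exists>ps. occurrence [1, 0] xs ps) \<longleftrightarrow> (\<exists>i j. occurrence [1, 0] xs [i, j])"
    by metis
  also have "\<dots> \<longleftrightarrow> (\<exists>i j. i < j \<and> j < length xs \<and> xs ! j < xs ! i)"
    by (intro ex_cong1) (auto simp: occurrence_def less_Suc_eq all_conj_distrib)
  finally show ?thesis
    by (simp add: avoids_def)
qed

lemma avoids_triple:
  "avoids xs [a, b, c] \<longleftrightarrow>
    \<not> (\<exists>i j k. i < j \<and> j < k \<and> k < length xs \<and> occurrence [a, b, c] xs [i, j, k])"
proof -
  have "\<exists>i j k. ps = [i, j, k]" if "occurrence [a, b, c] xs ps" for ps
    using that by (auto simp: occurrence_def length_Suc_conv)
  then have "(\<exists>ps. occurrence [a, b, c] xs ps) \<longleftrightarrow> (\<exists>i j k. occurrence [a, b, c] xs [i, j, k])"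
    by metis
  also have "\<dots> \<longleftrightarrow>
      (\<exists>i j k. i < j \<and> j < k \<and> k < length xs \<and> occurrence [a, b, c] xs [i, j, k])"
    by (intro ex_cong1) (auto simp: occurrence_def)
  finally show ?thesis
    by (simp add: avoids_def)
qed

text \<open>The bound has the form in which the simplifier leaves the length of a three-letter
  pattern.\<close>

lemma all_less_3: "(\<forall>a<Suc (Suc (Suc 0)). P a) \<longleftrightarrow> P 0 \<and> P 1 \<and> P 2"
  by (auto simp: less_Suc_eq numeral_2_eq_2 One_nat_def)

lemma avoids_001:
  "avoids xs [0, 0, 1] \<longleftrightarrow>
    \<not> (\<exists>i j k. i < j \<and> j < k \<and> k < length xs \<and> xs ! i = xs ! j \<and> xs ! j < xs ! k)"
  unfolding avoids_triple
  by (intro arg_cong[of _ _ Not] ex_cong1) (auto simp: occurrence_def all_less_3)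

lemma avoids_010:
  "avoids xs [0, 1, 0] \<longleftrightarrow>
    \<not> (\<exists>i j k. i < j \<and> j < k \<and> k < length xs \<and> xs ! i = xs ! k \<and> xs ! k < xs ! j)"
  unfolding avoids_triple
  by (intro arg_cong[of _ _ Not] ex_cong1) (auto simp: occurrence_def all_less_3)

lemma avoids_011:
  "avoids xs [0, 1, 1] \<longleftrightarrow>
    \<not> (\<exists>i j k. i < j \<and> j < k \<and> k < length xs \<and> xs ! j = xs ! k \<and> xs ! i < xs ! k)"
  unfolding avoids_triple
  by (intro arg_cong[of _ _ Not] ex_cong1) (auto simp: occurrence_def all_less_3)

text \<open>A triple of positions either lies within \<open>xs\<close> or uses the new entry,
  necessarily as its last member. The predicate \<open>Q\<close> lets this serve all three patterns
  of length three.\<close>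

lemma ex_triple_snoc:
  "(\<exists>i j k. i < j \<and> j < k \<and> k < length (xs @ [y]) \<and>
      Q ((xs @ [y]) ! i) ((xs @ [y]) ! j) ((xs @ [y]) ! k)) \<longleftrightarrow>
    (\<exists>i j k. i < j \<and> j < k \<and> k < length xs \<and> Q (xs ! i) (xs ! j) (xs ! k)) \<or>
    (\<exists>i j. i < j \<and> j < length xs \<and> Q (xs ! i) (xs ! j) y)" (is "?L \<longleftrightarrow> ?R1 \<or> ?R2")
proof
  assume ?L
  then obtain i j k where *: "i < j" "j < k" "k < length (xs @ [y])"
    "Q ((xs @ [y]) ! i) ((xs @ [y]) ! j) ((xs @ [y]) ! k)" by blast
  show "?R1 \<or> ?R2"
  proof (cases "k = length xs")
    case True
    with * have ?R2 by (auto simp: nth_append)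
    then show ?thesis ..
  next
    case False
    with * have "k < length xs" by simp
    with * have "i < j \<and> j < k \<and> k < length xs \<and> Q (xs ! i) (xs ! j) (xs ! k)"
      by (simp add: nth_append)
    then show ?thesis by blast
  qed
next
  assume "?R1 \<or> ?R2"
  then show ?L
  proof
    assume ?R1
    then obtain i j k where "i < j" "j < k" "k < length xs" "Q (xs ! i) (xs ! j) (xs ! k)"
      by blast
    then show ?L
      by (intro exI[of _ i] exI[of _ j] exI[of _ k]) (simp add: nth_append)
  next
    assume ?R2
    then obtain i j where "i < j" "j < length xs" "Q (xs ! i) (xs ! j) y"
      by blast
    then show ?L
      by (intro exI[of _ i] exI[of _ j] exI[of _ "length xs"]) (simp add: nth_append)
  qed
qed

lemma avoids_10_snoc:
  "avoids (xs @ [y]) [1, 0] \<longleftrightarrow> avoids xs [1, 0] \<and> (\<forall>x \<in> set xs. x \<le> y)"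
proof -
  \<comment> \<open>Avoiding 10 means being weakly increasing, so the library facts on
    \<open>sorted\<close> apply.\<close>
  have "sorted zs \<longleftrightarrow> avoids zs [1, 0]" for zs
    unfolding avoids_10 sorted_wrt_iff_nth_less by (meson not_le)
  then show ?thesis
    by (metis sorted_append sorted_wrt1 list.set_intros(1) empty_iff empty_set set_ConsD)
qed

lemma avoids_001_snoc:
  "avoids (xs @ [y]) [0, 0, 1] \<longleftrightarrow> avoids xs [0, 0, 1] \<and>
    \<not> (\<exists>i j. i < j \<and> j < length xs \<and> xs ! i = xs ! j \<and> xs ! j < y)"
  unfolding avoids_001 using ex_triple_snoc[of xs y "\<lambda>u v w. u = v \<and> v < w"] by blast

lemma avoids_010_snoc:
  "avoids (xs @ [y]) [0, 1, 0] \<longleftrightarrow> avoids xs [0, 1, 0] \<and>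
    \<not> (\<exists>i j. i < j \<and> j < length xs \<and> xs ! i = y \<and> y < xs ! j)"
  unfolding avoids_010 using ex_triple_snoc[of xs y "\<lambda>u v w. u = w \<and> w < v"] by blast

lemma avoids_011_snoc:
  "avoids (xs @ [y]) [0, 1, 1] \<longleftrightarrow> avoids xs [0, 1, 1] \<and>
    \<not> (\<exists>i j. i < j \<and> j < length xs \<and> xs ! j = y \<and> xs ! i < y)"
  unfolding avoids_011 using ex_triple_snoc[of xs y "\<lambda>u v w. v = w \<and> u < w"] by blast

section \<open>Values taken by avoiders of 10, 010 and 011\<close>

text \<open>An appended entry is at least the maximum \<open>asc xs\<close> and at most
  \<open>asc xs + 1\<close>. Hence the sequence stays level or climbs by exactly one, and skips no
  value.\<close>

lemma avoids_10_invariant: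
  "ascent_sequence xs \<Longrightarrow> avoids xs [1, 0] \<Longrightarrow> last xs = asc xs \<and> set xs = {..asc xs}"
proof (induction xs rule: rev_induct)
  case Nil
  then show ?case by (simp add: ascent_sequence_def)
next
  case (snoc y xs)
  show ?case
  proof (cases "xs = []")
    case True
    with snoc.prems show ?thesis by auto
  next
    case False
    with snoc have IH: "last xs = asc xs" "set xs = {..asc xs}" and y: "y \<le> Suc (asc xs)"
      and "\<forall>x \<in> set xs. x \<le> y"
      by (auto simp: ascent_sequence_snoc avoids_10_snoc)
    then have "asc xs \<le> y" by auto
    with y have "y = asc xs \<or> y = Suc (asc xs)" by auto
    with IH False show ?thesis
      by (elim disjE) (simp_all add: asc_snoc insert_absorb atMost_Suc One_nat_def)
  qed
qed

text \<open>A 010 contains a 10. Conversely, consider the first entry \<open>y\<close> that falls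
  below an earlier one: the prefix takes all values up to its last entry, so \<open>y\<close>
  occurred before that entry, and the two copies of \<open>y\<close> enclose a larger value.\<close>

lemma avoids_010_iff_avoids_10:
  "ascent_sequence xs \<Longrightarrow> avoids xs [0, 1, 0] \<longleftrightarrow> avoids xs [1, 0]"
proof (induction xs rule: rev_induct)
  case Nil
  then show ?case by (simp add: ascent_sequence_def)
next
  case (snoc y xs)
  show ?case
  proof (cases "xs = []")
    case True
    then show ?thesis by (auto simp: avoids_010 avoids_10)
  next
    case False
    with snoc have xs: "ascent_sequence xs" and IH: "avoids xs [0, 1, 0] \<longleftrightarrow> avoids xs [1, 0]"
      by (auto simp: ascent_sequence_snoc)
    \<comment> \<open>It suffices to compare the conditions on \<open>y\<close> for a prefix
      avoiding 10; for any other prefix both sides are false by \<open>IH\<close>.\<close>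
    have "(\<exists>i j. i < j \<and> j < length xs \<and> xs ! i = y \<and> y < xs ! j) \<longleftrightarrow> \<not> (\<forall>x \<in> set xs. x \<le> y)"
      if "avoids xs [1, 0]"
    proof
      assume "\<not> (\<forall>x \<in> set xs. x \<le> y)"
      moreover have inv: "last xs = asc xs" "set xs = {..asc xs}"
        using avoids_10_invariant[OF xs that] by auto
      ultimately have "y < asc xs" by auto
      with inv have less: "y < last xs" and "y \<in> set xs" by simp_all
      then obtain i where i: "i < length xs" "xs ! i = y"
        by (auto simp: in_set_conv_nth)
      have last: "last xs = xs ! (length xs - 1)"
        using False by (rule last_conv_nth)
      with i less have "i \<noteq> length xs - 1" by auto
      with i have "i < length xs - 1" by simp
      with i less last show "\<exists>i j. i < j \<and> j < length xs \<and> xs ! i = y \<and> y < xs ! j"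
        by (intro exI[of _ i] exI[of _ "length xs - 1"]) simp
    next
      assume "\<exists>i j. i < j \<and> j < length xs \<and> xs ! i = y \<and> y < xs ! j"
      then show "\<not> (\<forall>x \<in> set xs. x \<le> y)"
        by (metis nth_mem not_le)
    qed
    with IH show ?thesis
      unfolding avoids_010_snoc avoids_10_snoc by blast
  qed
qed

text \<open>Any \<open>y\<close> strictly between 0 and \<open>asc xs + 1\<close> already occurs
  after the initial 0, so repeating it completes a 011. Appending 0 is harmless since nothing is
  smaller, and \<open>Suc (asc xs)\<close> has no earlier copy.\<close>

lemma avoids_011_snoc_iff:
  assumes "ascent_sequence xs" and "set xs = {..asc xs}"
    and "y \<le> Suc (asc xs)" and "avoids xs [0, 1, 1]"
  shows "avoids (xs @ [y]) [0, 1, 1] \<longleftrightarrow> y = 0 \<or> y = Suc (asc xs)"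
proof
  assume avoid: "avoids (xs @ [y]) [0, 1, 1]"
  show "y = 0 \<or> y = Suc (asc xs)"
  proof (rule ccontr)
    assume "\<not> ?thesis"
    with assms have "0 < y" "y \<in> set xs" by auto
    then obtain j where j: "j < length xs" "xs ! j = y"
      by (auto simp: in_set_conv_nth)
    moreover have "xs ! 0 = 0"
      using assms(1) by (simp add: ascent_sequence_def)
    moreover have "0 < j"
      using j \<open>0 < y\<close> \<open>xs ! 0 = 0\<close> by (cases j) auto
    ultimately show False
      using avoid \<open>0 < y\<close> unfolding avoids_011_snoc by metis
  qed
next
  assume "y = 0 \<or> y = Suc (asc xs)"
  moreover have "xs ! j \<le> asc xs" if "j < length xs" for j
    using assms(2) nth_mem[OF that] by auto
  ultimately show "avoids (xs @ [y]) [0, 1, 1]"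
    using assms(4) unfolding avoids_011_snoc by force
qed

lemma avoids_011_invariant:
  "ascent_sequence xs \<Longrightarrow> avoids xs [0, 1, 1] \<Longrightarrow> set xs = {..asc xs}"
proof (induction xs rule: rev_induct)
  case Nil
  then show ?case by (simp add: ascent_sequence_def)
next
  case (snoc y xs)
  show ?case
  proof (cases "xs = []")
    case True
    with snoc.prems show ?thesis by auto
  next
    case False
    with snoc have xs: "ascent_sequence xs" "avoids xs [0, 1, 1]" "set xs = {..asc xs}"
      and y: "y \<le> Suc (asc xs)"
      by (auto simp: ascent_sequence_snoc avoids_011_snoc)
    then have "y = 0 \<or> y = Suc (asc xs)"
      using avoids_011_snoc_iff snoc.prems by blast
    \<comment> \<open>This makes an appended \<open>Suc (asc xs)\<close> an ascent, so the interval
      of values and its upper end grow together.\<close>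
    moreover have "last xs \<le> asc xs"
      using False xs(1) by (intro ascent_sequence_le_asc last_in_set)
    ultimately show ?thesis
      using False xs(3)
      by (elim disjE) (simp_all add: asc_snoc insert_absorb atMost_Suc One_nat_def le_imp_less_Suc)
  qed
qed

section \<open>Counting by appending an entry\<close>

lemma avoids_if_shorter:
  "length xs < length p \<Longrightarrow> avoids xs p"
proof -
  assume "length xs < length p"
  have "length ps \<le> length xs" if "sorted_wrt (<) ps" "set ps \<subseteq> {..<length xs}" for ps
    using that card_mono[of "{..<length xs}" "set ps"]
    by (simp add: strict_sorted_iff distinct_card)
  with \<open>length xs < length p\<close> show ?thesis
    by (force simp: avoids_def occurrence_def)
qed

lemma avoiders_length_1:
  assumes "2 \<le> length p"
  shows "{xs. ascent_sequence xs \<and> length xs = Suc 0 \<and> avoids xs p} = {[0]}"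
  using assms by (auto simp: length_Suc_conv intro: avoids_if_shorter)

text \<open>Appending \<open>h xs \<le> last xs\<close> preserves the number of ascents, and
  appending \<open>Suc (asc xs)\<close>, which exceeds every entry, raises it by one. The choices
  for \<open>h\<close> are \<open>asc\<close> for 10 and the constant 0 for 011.\<close>

lemma count_by_snoc:
  assumes "2 \<le> length p"
    and prefix: "\<And>xs y. avoids (xs @ [y]) p \<Longrightarrow> avoids xs p"
    and ext: "\<And>xs y. ascent_sequence xs \<Longrightarrow> avoids xs p \<Longrightarrow> y \<le> Suc (asc xs) \<Longrightarrow>
      avoids (xs @ [y]) p \<longleftrightarrow> y = h xs \<or> y = Suc (asc xs)"
    and h: "\<And>xs. ascent_sequence xs \<Longrightarrow> avoids xs p \<Longrightarrow> h xs \<le> last xs"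
  shows "card {xs. ascent_sequence xs \<and> length xs = Suc n \<and> avoids xs p} = 2 ^ n \<and>
    (\<forall>k. card {xs \<in> {xs. ascent_sequence xs \<and> length xs = Suc n \<and> avoids xs p}. asc xs = k}
      = n choose k)"
proof -
  let ?A = "\<lambda>n. {xs. ascent_sequence xs \<and> length xs = Suc n \<and> avoids xs p}"
  have ne: "xs \<noteq> []" and last: "last xs \<le> asc xs" and h_le: "h xs \<le> asc xs"
    if "ascent_sequence xs" "avoids xs p" for xs
  proof -
    show "xs \<noteq> []" using that by (simp add: ascent_sequence_def)
    then show "last xs \<le> asc xs" using that by (simp add: ascent_sequence_le_asc)
    then show "h xs \<le> asc xs" using h[OF that] by simp
  qed
  have step: "?A (Suc n) = (\<lambda>xs. xs @ [h xs]) ` ?A n \<union> (\<lambda>xs. xs @ [Suc (asc xs)]) ` ?A n"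
    (is "_ = ?F \<union> ?G") for n
  proof (intro equalityI subsetI)
    fix zs assume zs: "zs \<in> ?A (Suc n)"
    then obtain xs y where eq: "zs = xs @ [y]"
      by (cases zs rule: rev_cases) auto
    with zs have xs: "xs \<in> ?A n" "y \<le> Suc (asc xs)"
      using prefix by (auto simp: ascent_sequence_snoc split: if_splits)
    with zs eq have "y = h xs \<or> y = Suc (asc xs)"
      using ext by blast
    with xs eq show "zs \<in> ?F \<union> ?G" by blast
  next
    fix zs assume "zs \<in> ?F \<union> ?G"
    then obtain xs y where xs: "xs \<in> ?A n" and "zs = xs @ [y]"
      and "y = h xs \<or> y = Suc (asc xs)" by blast
    moreover from this have "y \<le> Suc (asc xs)"
      using h_le[of xs] by auto
    ultimately show "zs \<in> ?A (Suc n)"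
      using ext[of xs y] ne[of xs] by (simp add: ascent_sequence_snoc)
  qed
  show ?thesis
  proof (rule pascal_count[where A = ?A and s = asc])
    show "?A 0 = {[0]}"
      using avoiders_length_1[OF assms(1)] by simp
    \<comment> \<open>Equality would force \<open>x = y\<close> and then
      \<open>h x = Suc (asc x)\<close>, against \<open>h x \<le> asc x\<close>.\<close>
    show "\<And>n x y. x \<in> ?A n \<Longrightarrow> y \<in> ?A n \<Longrightarrow> x @ [h x] \<noteq> y @ [Suc (asc y)]"
      using h_le by fastforce
    show "\<And>n x. x \<in> ?A n \<Longrightarrow> asc (x @ [h x]) = asc x"
      using h by (auto simp: asc_snoc not_less)
    show "\<And>n x. x \<in> ?A n \<Longrightarrow> asc (x @ [Suc (asc x)]) = Suc (asc x)"
      using last ne by (auto simp: asc_snoc le_imp_less_Suc)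
  qed (fact step | simp add: inj_on_def)+
qed

section \<open>The pattern 001\<close>

text \<open>The leading 0 could only be the first letter of a 001, which would require a second 0
  among the positive entries.\<close>

lemma avoids_001_Cons_map_Suc:
  "avoids (0 # map Suc xs) [0, 0, 1] \<longleftrightarrow> avoids xs [0, 0, 1]"
proof
  assume L: "avoids (0 # map Suc xs) [0, 0, 1]"
  show "avoids xs [0, 0, 1]"
    unfolding avoids_001
  proof (safe)
    fix i j k assume "i < j" "j < k" "k < length xs" "xs ! i = xs ! j" "xs ! j < xs ! k"
    with L show False
      unfolding avoids_001
      by (elim notE, intro exI[of _ "Suc i"] exI[of _ "Suc j"] exI[of _ "Suc k"]) simp
  qed
next
  assume R: "avoids xs [0, 0, 1]"
  show "avoids (0 # map Suc xs) [0, 0, 1]"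
    unfolding avoids_001
  proof (safe)
    fix i j k
    let ?zs = "0 # map Suc xs"
    assume *: "i < j" "j < k" "k < length ?zs" "?zs ! i = ?zs ! j" "?zs ! j < ?zs ! k"
    then obtain j' k' where jk: "j = Suc j'" "k = Suc k'"
      by (metis less_nat_zero_code not0_implies_Suc)
    with * obtain i' where "i = Suc i'"
      by (cases i) auto
    with * jk R show False
      unfolding avoids_001 by auto
  qed
qed

lemma avoiders_001_Suc:
  fixes n :: nat
  defines "A \<equiv> \<lambda>n. {xs. ascent_sequence xs \<and> length xs = Suc n \<and> avoids xs [0, 0, 1]}"
  shows "A (Suc n) = (\<lambda>xs. xs @ [0]) ` A n \<union> (\<lambda>xs. 0 # map Suc xs) ` A n"
    (is "_ = ?F \<union> ?G")
proof (intro equalityI subsetI)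
  fix zs assume zs: "zs \<in> A (Suc n)"
  then obtain xs y where eq: "zs = xs @ [y]"
    by (cases zs rule: rev_cases) (auto simp: A_def)
  with zs have xs: "xs \<noteq> []" by (auto simp: A_def)
  show "zs \<in> ?F \<union> ?G"
  proof (cases "y = 0")
    case True
    with zs eq xs have "xs \<in> A n"
      by (auto simp: A_def ascent_sequence_snoc avoids_001_snoc)
    with eq True show ?thesis by blast
  next
    case False
    from zs have zs0: "zs ! 0 = 0" "zs \<noteq> []"
      by (auto simp: A_def ascent_sequence_def)
    then obtain ws where ws: "zs = 0 # ws"
      by (cases zs) auto
    \<comment> \<open>A second 0 would form a 001 with the initial 0 and the nonzero last entry
      \<open>y\<close>.\<close>
    have "0 \<notin> set ws"
    proof
      assume "0 \<in> set ws"
      then obtain i where i: "i < length ws" "ws ! i = 0"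
        by (auto simp: in_set_conv_nth)
      have last: "zs ! (length zs - 1) = y"
        by (simp add: eq)
      from i ws have "zs ! Suc i = 0" by simp
      with last False have "Suc i \<noteq> length zs - 1" by auto
      with i ws have "Suc i < length zs - 1" by auto
      moreover have "zs ! Suc i < zs ! (length zs - 1)"
        using \<open>zs ! Suc i = 0\<close> last False by simp
      ultimately have "\<exists>i j k. i < j \<and> j < k \<and> k < length zs \<and> zs ! i = zs ! j \<and> zs ! j < zs ! k"
        using zs0 \<open>zs ! Suc i = 0\<close>
        by (intro exI[of _ 0] exI[of _ "Suc i"] exI[of _ "length zs - 1"]) simp
      with zs show False
        unfolding A_def avoids_001 by blast
    qed
    \<comment> \<open>All entries of \<open>ws\<close> are positive, so the truncated subtraction
      loses nothing.\<close>
    then have "map Suc (map (\<lambda>x. x - 1) ws) = ws"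
      by (induction ws) auto
    then obtain us where us: "ws = map Suc us" by metis
    with zs ws have "us \<noteq> []" by (auto simp: A_def)
    with zs ws us have "us \<in> A n"
      by (auto simp: A_def ascent_sequence_Cons_map_Suc avoids_001_Cons_map_Suc)
    with ws us show ?thesis by blast
  qed
next
  fix zs assume "zs \<in> ?F \<union> ?G"
  then obtain xs where xs: "xs \<in> A n" and "zs = xs @ [0] \<or> zs = 0 # map Suc xs" by blast
  moreover from xs have "xs \<noteq> []" by (auto simp: A_def)
  \<comment> \<open>An appended 0 cannot be the largest letter of a 001, so it creates no
    occurrence.\<close>
  ultimately show "zs \<in> A (Suc n)"
    by (auto simp: A_def ascent_sequence_snoc avoids_001_snoc
      ascent_sequence_Cons_map_Suc avoids_001_Cons_map_Suc)
qed

lemma count_001: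
  "card {xs. ascent_sequence xs \<and> length xs = Suc n \<and> avoids xs [0, 0, 1]} = 2 ^ n \<and>
    (\<forall>k. card {xs \<in> {xs. ascent_sequence xs \<and> length xs = Suc n \<and> avoids xs [0, 0, 1]}.
      asc xs = k} = n choose k)"
proof -
  let ?A = "\<lambda>n. {xs. ascent_sequence xs \<and> length xs = Suc n \<and> avoids xs [0, 0, 1]}"
  show ?thesis
  proof (rule pascal_count[where A = ?A and s = asc])
    show "?A 0 = {[0]}"
      using avoiders_length_1[of "[0, 0, 1]"] by simp
    show "x @ [0] \<noteq> 0 # map Suc y" if "y \<in> ?A n" for n x y
    proof -
      \<comment> \<open>The last entry separates the two images: \<open>y\<close> is nonempty, so
        the shifted sequence ends in a successor.\<close>
      have "last (0 # map Suc y) \<noteq> 0"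
        using that by (cases y rule: rev_cases) auto
      then show ?thesis by (metis last_snoc)
    qed
    show "\<And>n x. x \<in> ?A n \<Longrightarrow> asc (x @ [0]) = asc x"
      by (simp add: asc_snoc)
    show "\<And>n x. x \<in> ?A n \<Longrightarrow> asc (0 # map Suc x) = Suc (asc x)"
      by (rule asc_Cons_map_Suc) auto
  qed (fact avoiders_001_Suc | simp add: inj_on_def)+
qed

section \<open>The remaining counts and the theorem\<close>

lemma count_10:
  "card {xs. ascent_sequence xs \<and> length xs = Suc n \<and> avoids xs [1, 0]} = 2 ^ n \<and>
    (\<forall>k. card {xs \<in> {xs. ascent_sequence xs \<and> length xs = Suc n \<and> avoids xs [1, 0]}.
      asc xs = k} = n choose k)"
proof (rule count_by_snoc[where h = asc])
  fix xs y
  assume xs: "ascent_sequence xs" "avoids xs [1, 0]"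
  then show "asc xs \<le> last xs"
    using avoids_10_invariant by simp
  assume "y \<le> Suc (asc xs)"
  \<comment> \<open>By the invariant the maximum of \<open>xs\<close> is \<open>asc xs\<close>,
    which leaves two choices for \<open>y\<close>.\<close>
  moreover have "(\<forall>x \<in> set xs. x \<le> y) \<longleftrightarrow> asc xs \<le> y"
    using avoids_10_invariant[OF xs] by auto
  ultimately show "avoids (xs @ [y]) [1, 0] \<longleftrightarrow> y = asc xs \<or> y = Suc (asc xs)"
    using xs by (auto simp: avoids_10_snoc)
qed (auto simp: avoids_10_snoc)

lemma count_011:
  "card {xs. ascent_sequence xs \<and> length xs = Suc n \<and> avoids xs [0, 1, 1]} = 2 ^ n \<and>
    (\<forall>k. card {xs \<in> {xs. ascent_sequence xs \<and> length xs = Suc n \<and> avoids xs [0, 1, 1]}.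
      asc xs = k} = n choose k)"
proof (rule count_by_snoc[where h = "\<lambda>_. 0"])
  show "avoids (xs @ [y]) [0, 1, 1] \<Longrightarrow> avoids xs [0, 1, 1]" for xs y
    by (simp add: avoids_011_snoc)
qed (simp_all add: avoids_011_snoc_iff avoids_011_invariant)

theorem theorem2p1:
  fixes p :: "nat list" and n :: nat
  assumes "p \<in> {[1, 0], [0, 0, 1], [0, 1, 0], [0, 1, 1]}"
    and "n \<ge> 1"
  shows "card {xs. ascent_sequence xs \<and> length xs = n \<and> avoids xs p} = 2 ^ (n - 1) \<and>
    (\<forall>k. card {xs. ascent_sequence xs \<and> length xs = n \<and> avoids xs p \<and> asc xs = k}
           = (n - 1) choose k)"
proof -
  obtain m where n: "n = Suc m"
    using assms(2) by (cases n) auto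
  let ?A = "\<lambda>p. {xs. ascent_sequence xs \<and> length xs = Suc m \<and> avoids xs p}"
  let ?P = "\<lambda>p. card (?A p) = 2 ^ m \<and> (\<forall>k. card {xs \<in> ?A p. asc xs = k} = m choose k)"
  have "?A [0, 1, 0] = ?A [1, 0]"
    using avoids_010_iff_avoids_10 by blast
  then have "?P [0, 1, 0]"
    using count_10 by (simp only: simp_thms)
  then have "?P p"
    using assms(1) count_10 count_001 count_011 by blast
  then show ?thesis
    by (simp add: n conj_assoc)
qed

end
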